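(* Suppose that $\alpha_{jk}=\alpha_{jj}$, $p_{jk}(\cdot|\cdot)=p_{jj}(\cdot|\cdot)$, $\pi_{jk}(\cdot|\cdot)=\pi_{jj}(\cdot|\cdot)$ and $\phi_{jk}=\phi_{jj}$ for all $k\ge2$ and $1\le j\le k-1$, that all mixture components are equivalent, and that $f(x|k,g,\phi_k)>0$ for all $k\ge1$, $g\in\mathcal G_k$. Let $\pi(k)\ge0$, $k=1,2,\dots$, not identically zero, be a (possibly improper) prior on the number of components. Then the posterior $\pi(k|x)\propto\pi(k)f_k$ of the number of components is a proper distribution (that is, $\sum_{k=1}^\infty\pi(k)f_k<\infty$) if and only if the prior is proper (that is, $\sum_{k=1}^\infty\pi(k)<\infty$).
   Context: Fix $n\ge1$ and data $x=(x_1,\dots,x_n)$. For each integer $k\ge1$ consider a mixture model with $k$ components. Its $j$th component ($1\le j\le k$) has density $p_{jk}(\cdot|\theta_{jk})$, the parameter $\theta_{jk}$ has prior probability density $\pi_{jk}(\cdot|\phi_{jk})$ with fixed hyperparameter $\phi_{jk}$, parameters being independent over $j$; the weights have a Dirichlet prior with hyperparameters $\alpha_{jk}>0$. Write $\phi_k=(\phi_{1k},\dots,\phi_{kk})$, $\alpha_k=(\alpha_{1k},\dots,\alpha_{kk})$, $\alpha_{0k}=\sum_{j=1}^k\alpha_{jk}$. Let $\mathcal G_k=\{1,\dots,k\}^n$ be the set of membership vectors $g=(g_1,\dots,g_n)$. For $g\in\mathcal G_k$ let $A_j=\{i:g_i=j\}$, $n_j=\operatorname{card}(A_j)$, $x^j=\{x_i:i\in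 A_j\}$. After integrating out weights and component parameters, $$f(g|k,\alpha_k)=\frac{\Gamma(\alpha_{0k})}{\Gamma(\alpha_{0k}+n)}\prod_{j=1}^k\frac{\Gamma(\alpha_{jk}+n_j)}{\Gamma(\alpha_{jk})},\qquad f(x|k,g,\phi_k)=\prod_{j=1}^k q_{jk}(x^j|\phi_{jk}),$$ $$q_{jk}(x^j|\phi_{jk})=\int\prod_{i\in A_j}p_{jk}(x_i|\theta)\,\pi_{jk}(\theta|\phi_{jk})\,d\theta,$$ which are assumed finite (and $q_{jk}=1$ when $A_j=\varnothing$). The marginal likelihood is $f_k=f(x|k,\phi_k,\alpha_k)=\sum_{g\in\mathcal G_k}f(x|k,g,\phi_k)f(g|k,\alpha_k)$. Components $j$ and $k$ are equivalent if $\alpha_{jj}=\alpha_{kk}$, $p_{jj}(\cdot|\cdot)=p_{kk}(\cdot|\cdot)$, $\pi_{jj}(\cdot|\cdot)=\pi_{kk}(\cdot|\cdot)$ and $\phi_{jj}=\phi_{kk}$. *)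

theory Defs
  imports "HOL-Analysis.Analysis"
begin

text \<open>
  Conventions. Observations live in a measure space \<open>L\<close> and component parameters in a measure
  space \<open>M\<close>; these carry the reference measures for the densities (\<open>d\<theta>\<close> is integration against
  \<open>M\<close>). The quantities of the \<open>j\<close>th component of the \<open>k\<close>-component model are \<open>\<alpha> j k\<close>,
  \<open>p j k \<theta> y\<close> (for \<open>p\<^sub>j\<^sub>k(y | \<theta>)\<close>), \<open>\<pi> j k h \<theta>\<close> (for \<open>\<pi>\<^sub>j\<^sub>k(\<theta> | h)\<close>) and \<open>\<phi> j k\<close>, and only
  arguments \<open>1 \<le> j \<le> k\<close> are meaningful. The data are \<open>x 1, \<dots>, x n\<close>.
\<close>

definition prob_density :: "'a measure \<Rightarrow> ('a \<Rightarrow> real) \<Rightarrow> bool" where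
  "prob_density N f \<longleftrightarrow> (\<forall>y\<in>space N. 0 \<le> f y) \<and> has_bochner_integral N f 1"

definition memberships :: "nat \<Rightarrow> nat \<Rightarrow> (nat \<Rightarrow> nat) set" where
  "memberships n k = ({1..n} \<rightarrow>\<^sub>E {1..k})"

definition cluster :: "nat \<Rightarrow> (nat \<Rightarrow> nat) \<Rightarrow> nat \<Rightarrow> nat set" where
  "cluster n g j = {i \<in> {1..n}. g i = j}"

text \<open>\<open>f(g | k, \<alpha>\<^sub>k)\<close>, the Dirichlet weights having been integrated out.\<close>

definition membership_prob ::
    "nat \<Rightarrow> (nat \<Rightarrow> nat \<Rightarrow> real) \<Rightarrow> nat \<Rightarrow> (nat \<Rightarrow> nat) \<Rightarrow> real" where
  "membership_prob n \<alpha> k g =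
     (let \<alpha>0 = (\<Sum>j=1..k. \<alpha> j k) in
        Gamma \<alpha>0 / Gamma (\<alpha>0 + real n) *
        (\<Prod>j=1..k. Gamma (\<alpha> j k + real (card (cluster n g j))) / Gamma (\<alpha> j k)))"

definition cluster_integrand ::
    "(nat \<Rightarrow> 'x) \<Rightarrow> (nat \<Rightarrow> nat \<Rightarrow> 't \<Rightarrow> 'x \<Rightarrow> real) \<Rightarrow>
     (nat \<Rightarrow> nat \<Rightarrow> 'h \<Rightarrow> 't \<Rightarrow> real) \<Rightarrow> (nat \<Rightarrow> nat \<Rightarrow> 'h) \<Rightarrow>
     nat \<Rightarrow> nat \<Rightarrow> nat set \<Rightarrow> 't \<Rightarrow> real" where
  "cluster_integrand x p \<pi> \<phi> j k A \<theta> = (\<Prod>i\<in>A. p j k \<theta> (x i)) * \<pi> j k (\<phi> j k) \<theta>"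

text \<open>
  \<open>q\<^sub>j\<^sub>k(x\<^sup>j | \<phi>\<^sub>j\<^sub>k)\<close> for the observations with indices in \<open>A\<close>. For empty \<open>A\<close> this is the total mass
  of the prior density, so it is 1.
\<close>

definition cluster_lik ::
    "'t measure \<Rightarrow> (nat \<Rightarrow> 'x) \<Rightarrow> (nat \<Rightarrow> nat \<Rightarrow> 't \<Rightarrow> 'x \<Rightarrow> real) \<Rightarrow>
     (nat \<Rightarrow> nat \<Rightarrow> 'h \<Rightarrow> 't \<Rightarrow> real) \<Rightarrow> (nat \<Rightarrow> nat \<Rightarrow> 'h) \<Rightarrow>
     nat \<Rightarrow> nat \<Rightarrow> nat set \<Rightarrow> real" where
  "cluster_lik M x p \<pi> \<phi> j k A = (LINT \<theta>|M. cluster_integrand x p \<pi> \<phi> j k A \<theta>)"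

text \<open>\<open>f(x | k, g, \<phi>\<^sub>k)\<close>\<close>

definition membership_lik ::
    "'t measure \<Rightarrow> nat \<Rightarrow> (nat \<Rightarrow> 'x) \<Rightarrow> (nat \<Rightarrow> nat \<Rightarrow> 't \<Rightarrow> 'x \<Rightarrow> real) \<Rightarrow>
     (nat \<Rightarrow> nat \<Rightarrow> 'h \<Rightarrow> 't \<Rightarrow> real) \<Rightarrow> (nat \<Rightarrow> nat \<Rightarrow> 'h) \<Rightarrow>
     nat \<Rightarrow> (nat \<Rightarrow> nat) \<Rightarrow> real" where
  "membership_lik M n x p \<pi> \<phi> k g = (\<Prod>j=1..k. cluster_lik M x p \<pi> \<phi> j k (cluster n g j))"

text \<open>\<open>f\<^sub>k = f(x | k, \<phi>\<^sub>k, \<alpha>\<^sub>k)\<close>\<close>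

definition marginal_lik ::
    "'t measure \<Rightarrow> nat \<Rightarrow> (nat \<Rightarrow> 'x) \<Rightarrow> (nat \<Rightarrow> nat \<Rightarrow> real) \<Rightarrow>
     (nat \<Rightarrow> nat \<Rightarrow> 't \<Rightarrow> 'x \<Rightarrow> real) \<Rightarrow> (nat \<Rightarrow> nat \<Rightarrow> 'h \<Rightarrow> 't \<Rightarrow> real) \<Rightarrow>
     (nat \<Rightarrow> nat \<Rightarrow> 'h) \<Rightarrow> nat \<Rightarrow> real" where
  "marginal_lik M n x \<alpha> p \<pi> \<phi> k =
     (\<Sum>g\<in>memberships n k. membership_lik M n x p \<pi> \<phi> k g * membership_prob n \<alpha> k g)"

text \<open>
  Equality of (families of) densities is equality on the underlying spaces, not on the whole types.
\<close>

definition components_equivalent ::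
    "'x measure \<Rightarrow> 't measure \<Rightarrow> (nat \<Rightarrow> nat \<Rightarrow> real) \<Rightarrow>
     (nat \<Rightarrow> nat \<Rightarrow> 't \<Rightarrow> 'x \<Rightarrow> real) \<Rightarrow> (nat \<Rightarrow> nat \<Rightarrow> 'h \<Rightarrow> 't \<Rightarrow> real) \<Rightarrow>
     (nat \<Rightarrow> nat \<Rightarrow> 'h) \<Rightarrow> nat \<Rightarrow> nat \<Rightarrow> bool" where
  "components_equivalent L M \<alpha> p \<pi> \<phi> j k \<longleftrightarrow>
     \<alpha> j j = \<alpha> k k \<and>
     (\<forall>\<theta>\<in>space M. \<forall>y\<in>space L. p j j \<theta> y = p k k \<theta> y) \<and>
     (\<forall>h. \<forall>\<theta>\<in>space M. \<pi> j j h \<theta> = \<pi> k k h \<theta>) \<and>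
     \<phi> j j = \<phi> k k"

end

theory Submission
  imports Defs
begin

text \<open>
  The idea is that \<open>f\<^sub>k\<close> stays between two positive constants that do not depend on \<open>k\<close>, so
  that multiplication by \<open>f\<^sub>k\<close> affects no question of summability.

  Indeed \<open>f\<^sub>k\<close> is an average of the likelihoods \<open>f(x | k, g, \<phi>\<^sub>k)\<close>: the probabilities
  \<open>f(g | k, \<alpha>\<^sub>k)\<close> sum to 1 (\<open>sum_membership_prob\<close>). Because the components are nested and
  equivalent, one function \<open>q\<close> of the cluster serves all components of all models, so the
  likelihood of \<open>g\<close> is \<open>\<Prod>j. q (A\<^sub>j)\<close>. Empty clusters contribute the factor 1 and nonempty ones
  are distinct, so this product sees only the set of clusters, neither their labels nor \<open>k\<close>
  (\<open>prod_clusters_eq_prod_image\<close>). There are only finitely many families of subsets of the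
  \<open>n\<close> observations. Hence, when \<open>k\<close> and \<open>g\<close> both vary, the likelihoods
  stay in one finite set of positive numbers, whose minimum and maximum are the required constants.
\<close>

section \<open>The Dirichlet-multinomial distribution\<close>

text \<open>
  This is the Polya urn. When a further observation \<open>u\<close> gets the label \<open>y\<close>, the product gains the
  factor \<open>a y + n\<^sub>y\<close>, where \<open>n\<^sub>y\<close> counts the earlier observations with that label; summed over \<open>y\<close>,
  these factors give the total weight of the urn, which is the same for all earlier assignments.
\<close>

lemma sum_prod_pochhammer_PiE:
  fixes a :: "'j \<Rightarrow> 'a::comm_semiring_1"
  assumes "finite A" "finite J"
  shows "(\<Sum>g\<in>A \<rightarrow>\<^sub>E J. \<Prod>j\<in>J. pochhammer (a j) (card {i\<in>A. g i = j})) =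
         pochhammer (\<Sum>j\<in>J. a j) (card A)"
  using assms(1)
proof (induction A)
  case empty
  then show ?case by simp
next
  case (insert u A)
  let ?F = "\<lambda>B g. \<Prod>j\<in>J. pochhammer (a j) (card {i\<in>B. g i = j})"
  have step: "?F (insert u A) (g(u := y)) = (a y + of_nat (card {i\<in>A. g i = y})) * ?F A g"
    if "y \<in> J" for g y
  proof -
    have "{i\<in>insert u A. (g(u := y)) i = j} =
        (if j = y then insert u {i\<in>A. g i = j} else {i\<in>A. g i = j})" for j
      using insert.hyps by auto
    hence "pochhammer (a j) (card {i\<in>insert u A. (g(u := y)) i = j}) =
        (if j = y then a y + of_nat (card {i\<in>A. g i = y}) else 1) *
        pochhammer (a j) (card {i\<in>A. g i = j})" for j
      using insert.hyps by (auto simp: pochhammer_Suc mult.commute)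
    thus ?thesis
      using that assms(2) by (simp add: prod.distrib)
  qed
  have total: "(\<Sum>y\<in>J. a y + of_nat (card {i\<in>A. g i = y})) = (\<Sum>j\<in>J. a j) + of_nat (card A)"
    if "g \<in> A \<rightarrow>\<^sub>E J" for g
  proof -
    have "(\<Sum>y\<in>J. card {i\<in>A. g i = y}) = card A"
      using sum.group[OF insert.hyps(1) assms(2), of g "\<lambda>_. 1::nat"] that by auto
    thus ?thesis by (simp add: sum.distrib flip: of_nat_sum)
  qed
  have "(\<Sum>g\<in>insert u A \<rightarrow>\<^sub>E J. ?F (insert u A) g) =
      (\<Sum>(y, g)\<in>J \<times> (A \<rightarrow>\<^sub>E J). ?F (insert u A) (g(u := y)))"
    unfolding PiE_insert_eq
    by (subst sum.reindex[OF inj_combinator[OF insert.hyps(2)]]) (simp add: case_prod_beta o_def)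
  also have "\<dots> = (\<Sum>g\<in>A \<rightarrow>\<^sub>E J. \<Sum>y\<in>J. ?F (insert u A) (g(u := y)))"
    by (subst sum.cartesian_product[symmetric], rule sum.swap)
  also have "\<dots> = (\<Sum>g\<in>A \<rightarrow>\<^sub>E J. ((\<Sum>j\<in>J. a j) + of_nat (card A)) * ?F A g)"
  proof (intro sum.cong refl)
    fix g assume g: "g \<in> A \<rightarrow>\<^sub>E J"
    have "(\<Sum>y\<in>J. ?F (insert u A) (g(u := y))) =
        (\<Sum>y\<in>J. a y + of_nat (card {i\<in>A. g i = y})) * ?F A g"
      unfolding sum_distrib_right by (intro sum.cong refl step)
    thus "(\<Sum>y\<in>J. ?F (insert u A) (g(u := y))) = ((\<Sum>j\<in>J. a j) + of_nat (card A)) * ?F A g"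
      by (simp only: total[OF g])
  qed
  also have "\<dots> = pochhammer (\<Sum>j\<in>J. a j) (card (insert u A))"
    using insert by (simp add: pochhammer_Suc mult.commute flip: sum_distrib_left)
  finally show ?case .
qed

lemma membership_prob_pochhammer:
  assumes "\<And>j. j \<in> {1..k} \<Longrightarrow> \<alpha> j k > 0" and "k \<ge> 1"
  shows "membership_prob n \<alpha> k g =
         (\<Prod>j=1..k. pochhammer (\<alpha> j k) (card (cluster n g j))) / pochhammer (\<Sum>j=1..k. \<alpha> j k) n"
proof -
  have ratio: "Gamma (z + real m) / Gamma z = pochhammer z m" if "z > 0" for z m
    using that by (subst pochhammer_Gamma) (auto elim!: nonpos_Ints_cases)
  have "(\<Sum>j=1..k. \<alpha> j k) > 0"
    using assms by (intro sum_pos) auto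
  hence "Gamma (\<Sum>j=1..k. \<alpha> j k) / Gamma ((\<Sum>j=1..k. \<alpha> j k) + real n) =
      1 / pochhammer (\<Sum>j=1..k. \<alpha> j k) n"
    by (simp flip: ratio)
  moreover have "(\<Prod>j=1..k. Gamma (\<alpha> j k + real (card (cluster n g j))) / Gamma (\<alpha> j k)) =
      (\<Prod>j=1..k. pochhammer (\<alpha> j k) (card (cluster n g j)))"
    using assms(1) by (intro prod.cong refl ratio)
  ultimately show ?thesis
    unfolding membership_prob_def Let_def by simp
qed

lemma membership_prob_nonneg:
  assumes "\<And>j. j \<in> {1..k} \<Longrightarrow> \<alpha> j k > 0" and "k \<ge> 1"
  shows "membership_prob n \<alpha> k g \<ge> 0"
  using assms
  by (subst membership_prob_pochhammer)
    (auto intro!: divide_nonneg_nonneg prod_nonneg pochhammer_nonneg sum_pos)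

lemma sum_membership_prob:
  assumes "\<And>j. j \<in> {1..k} \<Longrightarrow> \<alpha> j k > 0" and "k \<ge> 1"
  shows "(\<Sum>g\<in>memberships n k. membership_prob n \<alpha> k g) = 1"
proof -
  have "pochhammer (\<Sum>j=1..k. \<alpha> j k) n > 0"
    using assms by (intro pochhammer_pos sum_pos) auto
  moreover have "membership_prob n \<alpha> k g =
      (\<Prod>j=1..k. pochhammer (\<alpha> j k) (card (cluster n g j))) / pochhammer (\<Sum>j=1..k. \<alpha> j k) n" for g
    using assms by (rule membership_prob_pochhammer)
  ultimately show ?thesis
    using sum_prod_pochhammer_PiE[of "{1..n}" "{1..k}" "\<lambda>j. \<alpha> j k"]
    by (simp add: memberships_def cluster_def flip: sum_divide_distrib)
qed

section \<open>Likelihoods of membership vectors\<close>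

text \<open>
  This lemma turns the labelled product into one over unlabelled clusters: two labels can share a
  cluster only if it is empty, and then repeated factors do no harm.
\<close>

lemma prod_clusters_eq_prod_image:
  assumes "q {} = 1" and "finite J"
  shows "(\<Prod>j\<in>J. q (cluster n g j)) = prod q (cluster n g ` J)"
proof -
  have "prod q (cluster n g ` J) = prod (q \<circ> cluster n g) J"
  proof (rule prod.reindex_nontrivial[OF assms(2)])
    fix i j assume "i \<noteq> j" "cluster n g i = cluster n g j"
    hence "cluster n g i = {}" unfolding cluster_def by blast
    thus "q (cluster n g i) = 1" using assms(1) by simp
  qed
  thus ?thesis by (simp add: o_def)
qed

text \<open>
  The number \<open>k\<close> of factors is unbounded here, yet each value is determined by a family of subsets
  of \<open>{1..n}\<close>. This is what makes the bounds on \<open>f\<^sub>k\<close> uniform in \<open>k\<close>.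
\<close>

lemma finite_prod_clusters_values:
  assumes "q {} = 1"
  shows "finite {\<Prod>j=1..k. q (cluster n g j) | k g. True}"
proof (rule finite_subset)
  show "{\<Prod>j=1..k. q (cluster n g j) | k g. True} \<subseteq> prod q ` Pow (Pow {1..n})"
  proof safe
    fix k g
    have "cluster n g ` {1..k} \<in> Pow (Pow {1..n})"
      by (auto simp: cluster_def)
    thus "(\<Prod>j=1..k. q (cluster n g j)) \<in> prod q ` Pow (Pow {1..n})"
      using assms by (simp add: prod_clusters_eq_prod_image)
  qed
qed simp

lemma cluster_lik_cong:
  assumes "\<And>\<theta> i. \<theta> \<in> space M \<Longrightarrow> i \<in> A \<Longrightarrow> p j k \<theta> (x i) = p j' k' \<theta> (x i)"
    and "\<And>\<theta>. \<theta> \<in> space M \<Longrightarrow> \<pi> j k (\<phi> j k) \<theta> = \<pi> j' k' (\<phi> j' k') \<theta>"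
  shows "cluster_lik M x p \<pi> \<phi> j k A = cluster_lik M x p \<pi> \<phi> j' k' A"
  unfolding cluster_lik_def cluster_integrand_def
proof (rule Bochner_Integration.integral_cong[OF refl])
  fix \<theta> assume \<theta>: "\<theta> \<in> space M"
  have "(\<Prod>i\<in>A. p j k \<theta> (x i)) = (\<Prod>i\<in>A. p j' k' \<theta> (x i))"
    using assms(1)[OF \<theta>] by (rule prod.cong[OF refl])
  thus "(\<Prod>i\<in>A. p j k \<theta> (x i)) * \<pi> j k (\<phi> j k) \<theta> =
      (\<Prod>i\<in>A. p j' k' \<theta> (x i)) * \<pi> j' k' (\<phi> j' k') \<theta>"
    by (simp add: assms(2)[OF \<theta>])
qed

lemma cluster_lik_empty:
  assumes "prob_density M (\<pi> j k (\<phi> j k))"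
  shows "cluster_lik M x p \<pi> \<phi> j k {} = 1"
  using assms
  by (simp add: cluster_lik_def cluster_integrand_def prob_density_def has_bochner_integral_integral_eq)

section \<open>Bounds on the marginal likelihood and summability\<close>

text \<open>
  The marginal likelihood is a weighted average of membership likelihoods, so it inherits their
  bounds.
\<close>

lemma marginal_lik_bounds:
  assumes "\<And>j. j \<in> {1..k} \<Longrightarrow> \<alpha> j k > 0" and "k \<ge> 1"
    and "\<And>g. g \<in> memberships n k \<Longrightarrow> membership_lik M n x p \<pi> \<phi> k g \<in> {c..C}"
  shows "marginal_lik M n x \<alpha> p \<pi> \<phi> k \<in> {c..C}"
proof -
  let ?P = "membership_prob n \<alpha> k"
  have average: "(\<Sum>g\<in>memberships n k. b * ?P g) = b" for b
    using sum_membership_prob[of k \<alpha> n] assms(1,2) by (simp flip: sum_distrib_left)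
  have P_nonneg: "?P g \<ge> 0" for g
    using membership_prob_nonneg assms(1,2) by blast
  have "(\<Sum>g\<in>memberships n k. c * ?P g) \<le> marginal_lik M n x \<alpha> p \<pi> \<phi> k"
    unfolding marginal_lik_def
    using assms(3) P_nonneg by (intro sum_mono mult_right_mono) auto
  moreover have "marginal_lik M n x \<alpha> p \<pi> \<phi> k \<le> (\<Sum>g\<in>memberships n k. C * ?P g)"
    unfolding marginal_lik_def
    using assms(3) P_nonneg by (intro sum_mono mult_right_mono) auto
  ultimately show ?thesis by (simp add: average)
qed

lemma summable_on_mult_bounded_iff:
  fixes w f :: "'a \<Rightarrow> real"
  assumes "c > 0" and w: "\<And>k. k \<in> A \<Longrightarrow> w k \<ge> 0" and f: "\<And>k. k \<in> A \<Longrightarrow> f k \<in> {c..C}"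
  shows "(\<lambda>k. w k * f k) summable_on A \<longleftrightarrow> w summable_on A"
proof
  assume "(\<lambda>k. w k * f k) summable_on A"
  hence "(\<lambda>k. w k * f k * inverse c) summable_on A"
    by (rule summable_on_cmult_left)
  thus "w summable_on A"
  proof (rule summable_on_comparison_test)
    fix k assume k: "k \<in> A"
    have "w k * c \<le> w k * f k"
      using w[OF k] f[OF k] by (intro mult_left_mono) auto
    thus "w k \<le> w k * f k * inverse c"
      using \<open>c > 0\<close> by (simp add: field_simps)
  qed (use w in auto)
next
  assume "w summable_on A"
  hence "(\<lambda>k. w k * C) summable_on A"
    by (rule summable_on_cmult_left)
  thus "(\<lambda>k. w k * f k) summable_on A"
  proof (rule summable_on_comparison_test)
    fix k assume k: "k \<in> A"
    show "w k * f k \<le> w k * C"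
      using w[OF k] f[OF k] by (intro mult_left_mono) auto
    show "0 \<le> w k * f k"
      using w[OF k] f[OF k] \<open>c > 0\<close> by simp
  qed
qed

theorem theorem4p1:
  fixes n :: nat and x :: "nat \<Rightarrow> 'x"
    and L :: "'x measure" and M :: "'t measure"
    and \<alpha> :: "nat \<Rightarrow> nat \<Rightarrow> real"
    and p :: "nat \<Rightarrow> nat \<Rightarrow> 't \<Rightarrow> 'x \<Rightarrow> real"
    and \<pi> :: "nat \<Rightarrow> nat \<Rightarrow> 'h \<Rightarrow> 't \<Rightarrow> real"
    and \<phi> :: "nat \<Rightarrow> nat \<Rightarrow> 'h"
    and prior :: "nat \<Rightarrow> real"
  assumes n: "n \<ge> 1"
    and data: "\<And>i. i \<in> {1..n} \<Longrightarrow> x i \<in> space L"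
    and \<alpha>_pos: "\<And>j k. 1 \<le> j \<Longrightarrow> j \<le> k \<Longrightarrow> \<alpha> j k > 0"
    and p_density: "\<And>j k \<theta>. 1 \<le> j \<Longrightarrow> j \<le> k \<Longrightarrow> \<theta> \<in> space M \<Longrightarrow> prob_density L (p j k \<theta>)"
    and \<pi>_density: "\<And>j k. 1 \<le> j \<Longrightarrow> j \<le> k \<Longrightarrow> prob_density M (\<pi> j k (\<phi> j k))"
    and q_finite: "\<And>j k g. 1 \<le> j \<Longrightarrow> j \<le> k \<Longrightarrow> g \<in> memberships n k \<Longrightarrow>
          integrable M (cluster_integrand x p \<pi> \<phi> j k (cluster n g j))"
    and \<alpha>_nested: "\<And>j k. k \<ge> 2 \<Longrightarrow> 1 \<le> j \<Longrightarrow> j \<le> k - 1 \<Longrightarrow> \<alpha> j k = \<alpha> j j"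
    and p_nested: "\<And>j k \<theta> y. k \<ge> 2 \<Longrightarrow> 1 \<le> j \<Longrightarrow> j \<le> k - 1 \<Longrightarrow>
          \<theta> \<in> space M \<Longrightarrow> y \<in> space L \<Longrightarrow> p j k \<theta> y = p j j \<theta> y"
    and \<pi>_nested: "\<And>j k h \<theta>. k \<ge> 2 \<Longrightarrow> 1 \<le> j \<Longrightarrow> j \<le> k - 1 \<Longrightarrow>
          \<theta> \<in> space M \<Longrightarrow> \<pi> j k h \<theta> = \<pi> j j h \<theta>"
    and \<phi>_nested: "\<And>j k. k \<ge> 2 \<Longrightarrow> 1 \<le> j \<Longrightarrow> j \<le> k - 1 \<Longrightarrow> \<phi> j k = \<phi> j j"
    and equivalent: "\<And>j k. 1 \<le> j \<Longrightarrow> 1 \<le> k \<Longrightarrow> components_equivalent L M \<alpha> p \<pi> \<phi> j k"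
    and lik_pos: "\<And>k g. k \<ge> 1 \<Longrightarrow> g \<in> memberships n k \<Longrightarrow> membership_lik M n x p \<pi> \<phi> k g > 0"
    and prior_nonneg: "\<And>k. k \<ge> 1 \<Longrightarrow> prior k \<ge> 0"
    and prior_nonzero: "\<exists>k\<ge>1. prior k \<noteq> 0"
  shows "(\<lambda>k. prior k * marginal_lik M n x \<alpha> p \<pi> \<phi> k) summable_on {1..} \<longleftrightarrow>
         prior summable_on {1..}"
proof -
  define q where "q = cluster_lik M x p \<pi> \<phi> 1 1"
  have q_empty: "q {} = 1"
    unfolding q_def by (intro cluster_lik_empty \<pi>_density) auto
  \<comment> \<open>Nestedness carries component \<open>j\<close> of model \<open>k\<close> to component \<open>j\<close> of model \<open>j\<close>, and equivalence
      carries that one to the only component of model 1.\<close>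
  have q_common: "cluster_lik M x p \<pi> \<phi> j k (cluster n g j) = q (cluster n g j)"
    if j: "1 \<le> j" "j \<le> k" for j k g
    unfolding q_def
  proof (rule cluster_lik_cong)
    fix \<theta> assume \<theta>: "\<theta> \<in> space M"
    have equiv: "components_equivalent L M \<alpha> p \<pi> \<phi> j 1"
      using equivalent j by simp
    show "\<pi> j k (\<phi> j k) \<theta> = \<pi> 1 1 (\<phi> 1 1) \<theta>"
      using equiv \<pi>_nested[of k j] \<phi>_nested[of k j] j \<theta>
      by (cases "j = k") (auto simp: components_equivalent_def)
    fix i assume "i \<in> cluster n g j"
    hence "x i \<in> space L" using data by (auto simp: cluster_def)
    thus "p j k \<theta> (x i) = p 1 1 \<theta> (x i)"
      using equiv p_nested[of k j] j \<theta>
      by (cases "j = k") (auto simp: components_equivalent_def)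
  qed
  have lik: "membership_lik M n x p \<pi> \<phi> k g = (\<Prod>j=1..k. q (cluster n g j))" for k g
    unfolding membership_lik_def by (intro prod.cong refl q_common) auto

  \<comment> \<open>The likelihoods of all membership vectors of all models lie in \<open>V\<close>. Functions \<open>g\<close> with values
      outside \<open>{1..k}\<close> may yield nonpositive products, hence the restriction \<open>v > 0\<close>.\<close>
  define V where "V = {v \<in> {\<Prod>j=1..k. q (cluster n g j) | k g. True}. v > 0}"
  have V_finite: "finite V"
    unfolding V_def using finite_prod_clusters_values[of q n, OF q_empty] by simp
  have lik_V: "membership_lik M n x p \<pi> \<phi> k g \<in> V" if "k \<ge> 1" "g \<in> memberships n k" for k g
    using lik_pos[OF that] unfolding V_def lik by blast
  have V_nonempty: "V \<noteq> {}"
    using lik_V[of 1 "\<lambda>i\<in>{1..n}. 1"] by (auto simp: memberships_def)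

  have "membership_lik M n x p \<pi> \<phi> k g \<in> {Min V..Max V}" if "k \<ge> 1" "g \<in> memberships n k" for k g
    using lik_V[OF that] V_finite by simp
  hence "marginal_lik M n x \<alpha> p \<pi> \<phi> k \<in> {Min V..Max V}" if "k \<ge> 1" for k
    using that \<alpha>_pos by (intro marginal_lik_bounds) auto
  moreover have "Min V > 0"
    using Min_in[OF V_finite V_nonempty] by (simp add: V_def)
  ultimately show ?thesis
    using prior_nonneg by (intro summable_on_mult_bounded_iff[where c = "Min V" and C = "Max V"]) auto
qed

end
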